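(* Let $\beta\in\mathbb{R}$ be fixed, and for each integer $n\ge 1$ put $x=\sqrt{2n}+\beta n^{-1/6}$. Then, as $n\to\infty$, $$H_{n}(x)=\exp\left[\frac{n}{2}\ln(2n)-\frac{3}{2}n+\sqrt{2n}\,x\right]\sqrt{2\pi}\,n^{1/6}\left\{\operatorname{Ai}\left[\sqrt{2}\left(x-\sqrt{2n}\right)n^{1/6}\right]+o(1)\right\}.$$
   Context: $H_n$ denotes the $n$-th (physicists') Hermite polynomial, $H_{n}(x)=(-1)^{n}e^{x^{2}}\frac{d^{n}}{dx^{n}}e^{-x^{2}}$, $n=0,1,2,\ldots$. $\operatorname{Ai}$ denotes the Airy function of the first kind. *)

theory Defs
  imports "HOL-Analysis.Analysis" "HOL-Library.Landau_Symbols"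
begin

definition hermite :: "nat \<Rightarrow> real \<Rightarrow> real" where
  "hermite n x = (-1) ^ n * exp (x\<^sup>2) * (deriv ^^ n) (\<lambda>t. exp (- (t\<^sup>2))) x"

text \<open>
  The Airy function of the first kind on the real line. The integral over the half-line
  converges only conditionally, so it is not a Lebesgue integral and is taken as the
  limit of the integrals over bounded intervals.
\<close>
definition Airy_Ai :: "real \<Rightarrow> real" where
  "Airy_Ai x = (1 / pi) * Lim at_top (\<lambda>R. integral {0..R} (\<lambda>t. cos (t ^ 3 / 3 + x * t)))"

end

theory Submission imports Defs "HOL-Probability.Probability" "HOL-Real_Asymp.Real_Asymp"
begin

text \<open>
  For every real \<open>c\<close>, and with \<open>T\<close> a standard normal variable,
  \<open>H\<^sub>n(x) = exp ((x - c)\<^sup>2) * E[(2 c + i sqrt 2 T)\<^sup>n * exp (i sqrt 2 (c - x) T)]\<close>.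
  This is an integral of \<open>z\<^sup>n exp ((z - x)\<^sup>2)\<close> along the vertical line \<open>Re z = c\<close>,
  and the freedom in \<open>c\<close> replaces a contour shift. For \<open>x = sqrt (2 n)\<close> the two saddle
  points of the integrand merge at \<open>sqrt (n / 2)\<close>, which is therefore the right value
  of \<open>c\<close>.

  Put \<open>k = n powr (1/3)\<close>, \<open>T = sqrt k * v\<close> and \<open>u = v / k\<close>. The modulus of the integrand
  becomes, apart from a constant factor, \<open>exp (n/2 * (ln (1 + u\<^sup>2) - u\<^sup>2))\<close>, which tends to 1 for fixed \<open>v\<close>, and its
  phase becomes, up to sign, \<open>n * (u - arctan u) + \<xi> * v\<close> with \<open>\<xi> = sqrt 2 * \<beta>\<close>, which
  tends to \<open>v\<^sup>3/3 + \<xi> * v\<close>. This is the phase of the Airy integral, so on every bounded interval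
  the integrals converge by dominated convergence.

  The Airy integral converges only conditionally, hence no integrable majorant exists on the
  whole half-line and the tails need the oscillation. The derivative of the phase,
  \<open>v\<^sup>2 / (1 + u\<^sup>2) + \<xi>\<close>, increases in \<open>v\<close>, and the modulus decreases. By the second mean
  value theorem the integral over \<open>[R, S]\<close> is at most 4 divided by the derivative of the phase
  at \<open>R\<close>, that is, small for large \<open>R\<close>, uniformly in \<open>S\<close> and all \<open>n\<close> with \<open>k \<ge> R\<close>
  (\<open>oscillatory_integral_bound\<close>, \<open>airy_wave_tail_bound\<close>). Such uniform tails allow the
  interchange of the limits \<open>R \<rightarrow> \<infinity>\<close> and \<open>n \<rightarrow> \<infinity>\<close> (\<open>improper_limit_interchange\<close>), which also
  yields the convergence of the Airy integral.
\<close>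

section \<open>Recurrences for Hermite polynomials\<close>

text \<open>
  Differentiating the instance for \<open>n\<close> gives the instance for \<open>n + 1\<close>. Since \<open>deriv\<close> has a meaning
  only at points of differentiability, the induction carries the differentiability of two
  consecutive derivatives along.
\<close>
lemma gaussian_deriv_recurrence:
  fixes x :: real
  defines "D \<equiv> \<lambda>n. (deriv ^^ n) (\<lambda>t::real. exp (- (t\<^sup>2)))"
  shows "D (Suc (Suc n)) x = - 2 * x * D (Suc n) x - 2 * (real n + 1) * D n x"
proof -
  have "(\<forall>x. (D n has_field_derivative D (Suc n) x) (at x)) \<and>
    (\<forall>x. (D (Suc n) has_field_derivative D (Suc (Suc n)) x) (at x)) \<and>
    (\<forall>x. D (Suc (Suc n)) x = - 2 * x * D (Suc n) x - 2 * (real n + 1) * D n x)"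
  proof (induction n)
    case 0
    have d0: "(D 0 has_field_derivative - 2 * x * D 0 x) (at x)" for x
      unfolding D_def by (auto intro!: derivative_eq_intros)
    then have D1: "D (Suc 0) = (\<lambda>x. - 2 * x * D 0 x)"
      by (auto simp: D_def fun_eq_iff intro!: DERIV_imp_deriv)
    have d1: "(D (Suc 0) has_field_derivative - 2 * x * D (Suc 0) x - 2 * D 0 x) (at x)" for x
      unfolding D1 by (auto intro!: derivative_eq_intros d0 simp: algebra_simps)
    then have D2: "D (Suc (Suc 0)) = (\<lambda>x. - 2 * x * D (Suc 0) x - 2 * D 0 x)"
      by (auto simp: D_def fun_eq_iff intro!: DERIV_imp_deriv)
    show ?case using d0 d1 D1 D2 by simp
  next
    case (Suc n)
    then have d0: "(D n has_field_derivative D (Suc n) x) (at x)"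
      and d1: "(D (Suc n) has_field_derivative D (Suc (Suc n)) x) (at x)"
      and D2: "D (Suc (Suc n)) = (\<lambda>x. - 2 * x * D (Suc n) x - 2 * (real n + 1) * D n x)" for x
      by (auto simp: fun_eq_iff)
    have d2: "(D (Suc (Suc n)) has_field_derivative
        - 2 * x * D (Suc (Suc n)) x - 2 * (real (Suc n) + 1) * D (Suc n) x) (at x)" for x
      by (subst D2) (auto intro!: derivative_eq_intros d0 d1 simp: algebra_simps)
    then have D3: "D (Suc (Suc (Suc n))) x =
        - 2 * x * D (Suc (Suc n)) x - 2 * (real (Suc n) + 1) * D (Suc n) x" for x
      by (auto simp: D_def intro!: DERIV_imp_deriv)
    show ?case using d1 d2 D3 by simp
  qed
  then show ?thesis by auto
qed

lemma hermite_0: "hermite 0 x = 1"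
  by (simp add: hermite_def flip: exp_add)

lemma hermite_1: "hermite (Suc 0) x = 2 * x"
proof -
  have "deriv (\<lambda>t::real. exp (- (t\<^sup>2))) x = - 2 * x * exp (- (x\<^sup>2))"
    by (auto intro!: DERIV_imp_deriv derivative_eq_intros)
  then show ?thesis by (simp add: hermite_def exp_minus field_simps)
qed

lemma hermite_rec:
  "hermite (Suc (Suc n)) x = 2 * x * hermite (Suc n) x - 2 * (real n + 1) * hermite n x"
  unfolding hermite_def gaussian_deriv_recurrence by (simp add: algebra_simps)

section \<open>Hermite polynomials as oscillating Gaussian integrals\<close>

text \<open>
  With \<open>z = c + i t / sqrt 2\<close> and \<open>b = sqrt 2 * (c - x)\<close>, the exponent of
  \<open>exp ((z - x)\<^sup>2)\<close> is \<open>(c - x)\<^sup>2 + i b t - t\<^sup>2 / 2\<close>. Hence this is \<open>(2 z)\<^sup>k exp ((z - x)\<^sup>2)\<close> on the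
  line \<open>Re z = c\<close>, up to the constant factor \<open>exp ((x - c)\<^sup>2) * sqrt (2 * pi)\<close>.
\<close>
definition gauss_wave :: "real \<Rightarrow> real \<Rightarrow> nat \<Rightarrow> real \<Rightarrow> complex" where
  "gauss_wave c b k t =
     std_normal_density t *\<^sub>R ((2 * c + \<i> * (sqrt 2 * t)) ^ k * cis (b * t))"

text \<open>
  A crude polynomial bound suffices, both for integrability and for the decay at infinity.
\<close>
lemma norm_gauss_wave_le:
  "norm (gauss_wave c b k t) \<le> std_normal_density t * (1 + 2 * \<bar>c\<bar> + 2 * \<bar>t\<bar>) ^ k"
proof -
  have "norm (2 * c + \<i> * (sqrt 2 * t)) \<le> 2 * \<bar>c\<bar> + sqrt 2 * \<bar>t\<bar>"
    by (rule order.trans[OF norm_triangle_ineq]) (simp add: norm_mult)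
  also have "sqrt 2 * \<bar>t\<bar> \<le> 2 * \<bar>t\<bar>"
    by (intro mult_right_mono) (auto intro: real_le_lsqrt)
  finally have "norm (2 * c + \<i> * (sqrt 2 * t)) \<le> 1 + 2 * \<bar>c\<bar> + 2 * \<bar>t\<bar>" by simp
  then show ?thesis
    by (auto simp: gauss_wave_def norm_mult norm_power intro!: mult_left_mono power_mono)
qed

lemma continuous_gauss_wave: "continuous_on UNIV (gauss_wave c b k)"
  unfolding gauss_wave_def std_normal_density_def by (intro continuous_intros) auto

lemma integrable_gauss_wave: "integrable lborel (gauss_wave c b k)"
proof (rule Bochner_Integration.integrable_bound)
  have "integrable lborel (\<lambda>t. \<Sum>j\<le>k. real (k choose j) * (1 + 2 * \<bar>c\<bar>) ^ j * 2 ^ (k - j) *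
          (std_normal_density t * \<bar>t\<bar> ^ (k - j)))"
    by (intro Bochner_Integration.integrable_sum integrable_mult_right
          integrable_std_normal_moment_abs)
  also have "(\<lambda>t. \<Sum>j\<le>k. real (k choose j) * (1 + 2 * \<bar>c\<bar>) ^ j * 2 ^ (k - j) *
          (std_normal_density t * \<bar>t\<bar> ^ (k - j))) =
        (\<lambda>t. std_normal_density t * (1 + 2 * \<bar>c\<bar> + 2 * \<bar>t\<bar>) ^ k)"
    by (subst binomial_ring) (simp add: sum_distrib_left power_mult_distrib mult_ac)
  finally show "integrable lborel (\<lambda>t. std_normal_density t * (1 + 2 * \<bar>c\<bar> + 2 * \<bar>t\<bar>) ^ k)" .
  show "gauss_wave c b k \<in> borel_measurable lborel"
    using borel_measurable_continuous_onI[OF continuous_gauss_wave] by simp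
  show "AE t in lborel. norm (gauss_wave c b k t)
      \<le> norm (std_normal_density t * (1 + 2 * \<bar>c\<bar> + 2 * \<bar>t\<bar>) ^ k)"
    using norm_gauss_wave_le[of c b k] by (auto intro!: AE_I2 order.trans[OF _ abs_ge_self])
qed

lemma gauss_wave_tendsto_0:
  "(gauss_wave c b k \<longlongrightarrow> 0) at_top" "(gauss_wave c b k \<longlongrightarrow> 0) at_bot"
proof -
  define C where "C = 1 + 2 * \<bar>c\<bar>"
  have C: "C > 0" by (simp add: C_def)
  have "((\<lambda>t. std_normal_density t * (C + 2 * \<bar>t\<bar>) ^ k) \<longlongrightarrow> 0) at_top"
       "((\<lambda>t. std_normal_density t * (C + 2 * \<bar>t\<bar>) ^ k) \<longlongrightarrow> 0) at_bot"
    unfolding std_normal_density_def using C by real_asymp+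
  moreover have "norm (gauss_wave c b k t) \<le> std_normal_density t * (C + 2 * \<bar>t\<bar>) ^ k" for t
    using norm_gauss_wave_le by (simp add: C_def)
  ultimately show "(gauss_wave c b k \<longlongrightarrow> 0) at_top" "(gauss_wave c b k \<longlongrightarrow> 0) at_bot"
    by (auto intro!: Lim_null_comparison[where f = "gauss_wave c b k"])
qed

lemma integral_derivative_eq_0:
  fixes F f :: "real \<Rightarrow> 'a :: euclidean_space"
  assumes "\<And>t. (F has_vector_derivative f t) (at t)" "continuous_on UNIV f" "integrable lborel f"
    and "(F \<longlongrightarrow> 0) at_top" "(F \<longlongrightarrow> 0) at_bot"
  shows "integral\<^sup>L lborel f = 0"
proof -
  have "(LBINT t=-\<infinity>..\<infinity>. f t) = 0 - 0"
  proof (rule interval_integral_FTC_integrable[where F = F])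
    show "isCont f t" for t using assms(2) by (simp add: continuous_on_eq_continuous_at)
    show "((F \<circ> real_of_ereal) \<longlongrightarrow> 0) (at_right (-\<infinity>))" "((F \<circ> real_of_ereal) \<longlongrightarrow> 0) (at_left \<infinity>)"
      using assms(4,5) by (simp_all add: ereal_tendsto_simps)
    show "set_integrable lborel (einterval (-\<infinity>) \<infinity>) f"
      using assms(3) by (simp add: set_integrable_def)
  qed (use assms(1) in auto)
  then show ?thesis
    by (simp add: interval_lebesgue_integral_def set_lebesgue_integral_def)
qed

lemma integral_gauss_wave_0: "integral\<^sup>L lborel (gauss_wave c b 0) = exp (- (b\<^sup>2 / 2))"
proof -
  have "integral\<^sup>L lborel (gauss_wave c b 0) = char std_normal_distribution b"
    unfolding char_def gauss_wave_def
    by (subst integral_density) (auto simp: cis_conv_exp scaleR_conv_of_real)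
  then show ?thesis by (simp add: char_std_normal_distribution)
qed

text \<open>
  The logarithmic derivative in \<open>t\<close> is \<open>i b - t + i k sqrt 2 / w\<close> with
  \<open>w = 2 c + i sqrt 2 t\<close>. The relation between \<open>b\<close>, \<open>c\<close> and \<open>x\<close> makes \<open>i b - t\<close> a multiple
  of \<open>w - 2 x\<close>, so that the derivative is a combination of the waves with exponents \<open>k + 1\<close>,
  \<open>k\<close> and \<open>k - 1\<close>. For \<open>k = 0\<close> the truncated index \<open>k - 1\<close> has the coefficient 0.
\<close>
lemma gauss_wave_has_derivative:
  assumes "b = sqrt 2 * (c - x)"
  shows "(gauss_wave c b k has_vector_derivative
     (\<i> / sqrt 2) * (gauss_wave c b (Suc k) t - 2 * of_real x * gauss_wave c b k t
        + 2 * of_nat k * gauss_wave c b (k - 1) t)) (at t)"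
proof -
  \<comment> \<open>The wave extends to an entire function of \<open>t\<close>; this splits it into Gaussian and power.\<close>
  define w where "w z = 2 * complex_of_real c + \<i> * (sqrt 2 * z)" for z :: complex
  define E where "E z = exp (- z\<^sup>2 / 2) * exp (\<i> * b * z) / sqrt (2 * pi)" for z :: complex
  have wave: "gauss_wave c b j = (\<lambda>t. E (of_real t) * w (of_real t) ^ j)" for j
    by (auto simp: gauss_wave_def std_normal_density_def E_def w_def cis_conv_exp
          scaleR_conv_of_real exp_of_real mult_ac simp flip: exp_of_real)
  have w': "(w has_field_derivative \<i> * sqrt 2) (at z)" for z
    unfolding w_def by (auto intro!: derivative_eq_intros)
  have E': "(E has_field_derivative (\<i> * b - z) * E z) (at z)" for z
    unfolding E_def by (auto intro!: derivative_eq_intros simp: field_simps)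
  have "((\<lambda>z. E z * w z ^ k) has_field_derivative
      (\<i> * b - z) * E z * w z ^ k + E z * (k * w z ^ (k - 1) * (\<i> * sqrt 2))) (at z)" for z
    by (auto intro!: derivative_eq_intros w' E' simp: algebra_simps)
  moreover have "(\<i> * b - z) * E z * w z ^ k + E z * (k * w z ^ (k - 1) * (\<i> * sqrt 2)) =
      (\<i> / sqrt 2) * (E z * w z ^ Suc k - 2 * of_real x * (E z * w z ^ k) + 2 * of_nat k * (E z * w z ^ (k - 1)))" for z
  proof -
    have s: "complex_of_real (sqrt 2) * complex_of_real (sqrt 2) = 2"
      by (simp flip: of_real_mult)
    have 1: "\<i> * b - z = \<i> / sqrt 2 * (w z - 2 * x)"
      using s by (simp add: w_def assms field_simps)
    have 2: "\<i> * sqrt 2 = \<i> / sqrt 2 * 2" using s by (simp add: field_simps)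
    show ?thesis
      unfolding 1 2 by (simp add: algebra_simps)
  qed
  ultimately show ?thesis
    unfolding wave by (intro has_vector_derivative_real_field) (simp only:)
qed

text \<open>
  The derivative above integrates to 0, which turns it into the three-term recurrence of the
  Hermite polynomials.
\<close>
lemma integral_gauss_wave_rec:
  assumes "b = sqrt 2 * (c - x)"
  shows "integral\<^sup>L lborel (gauss_wave c b (Suc k)) =
     2 * of_real x * integral\<^sup>L lborel (gauss_wave c b k) - 2 * of_nat k * integral\<^sup>L lborel (gauss_wave c b (k - 1))"
proof -
  let ?f = "\<lambda>t. (\<i> / sqrt 2) * (gauss_wave c b (Suc k) t - 2 * of_real x * gauss_wave c b k t
        + 2 * of_nat k * gauss_wave c b (k - 1) t)"
  note [simp] = integrable_gauss_wave
  have "integral\<^sup>L lborel ?f = 0"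
  proof (rule integral_derivative_eq_0)
    show "(gauss_wave c b k has_vector_derivative ?f t) (at t)" for t
      by (rule gauss_wave_has_derivative[OF assms])
    show "continuous_on UNIV ?f"
      by (intro continuous_intros continuous_gauss_wave)
    show "integrable lborel ?f" by simp
  qed (rule gauss_wave_tendsto_0)+
  then have "integral\<^sup>L lborel (gauss_wave c b (Suc k)) -
      2 * of_real x * integral\<^sup>L lborel (gauss_wave c b k) +
      2 * of_nat k * integral\<^sup>L lborel (gauss_wave c b (k - 1)) = 0"
    by simp
  then show ?thesis by (simp add: algebra_simps)
qed

text \<open>
  Both sides satisfy the same recurrence and agree for \<open>n = 0\<close>, where the right-hand side is the
  characteristic function of the normal distribution. The recurrence for the integrals at index 0
  yields the value for \<open>n = 1\<close>.
\<close>
lemma hermite_eq_integral_gauss_wave: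
  fixes c x :: real
  shows "hermite n x = exp ((x - c)\<^sup>2) * integral\<^sup>L lborel (gauss_wave c (sqrt 2 * (c - x)) n)"
proof -
  define b where "b = sqrt 2 * (c - x)"
  let ?J = "\<lambda>n. exp ((x - c)\<^sup>2) * integral\<^sup>L lborel (gauss_wave c b n)"
  have "b\<^sup>2 / 2 = (x - c)\<^sup>2" by (simp add: b_def power_mult_distrib power2_commute)
  then have J0: "?J 0 = 1" by (simp add: integral_gauss_wave_0 flip: of_real_mult exp_add)
  note rec = integral_gauss_wave_rec[OF b_def]
  have "complex_of_real (hermite n x) = ?J n \<and> complex_of_real (hermite (Suc n) x) = ?J (Suc n)"
  proof (induction n)
    case 0
    then show ?case using J0 rec[of 0] by (simp add: hermite_0 hermite_1)
  next
    case (Suc n)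
    then show ?case by (simp add: hermite_rec rec[of "Suc n"] algebra_simps)
  qed
  then show ?thesis by (simp add: b_def)
qed

section \<open>Integrals with monotone phase derivative\<close>

text \<open>
  Writing the integrand as \<open>(A / \<phi>') * (\<phi>' * cos \<phi>)\<close> exhibits a decreasing factor with values in
  \<open>[0, 1 / m]\<close> and a factor with the bounded antiderivative \<open>sin \<phi>\<close>; the second mean value theorem
  bounds the integral of such a product. The estimate does not depend on the length of the interval.
\<close>
lemma oscillatory_integral_bound:
  fixes A \<phi> \<phi>' :: "real \<Rightarrow> real"
  assumes "a \<le> b"
    and \<phi>: "\<And>t. t \<in> {a..b} \<Longrightarrow> (\<phi> has_real_derivative \<phi>' t) (at t)"
    and mono: "mono_on {a..b} \<phi>'" and m: "0 < m" "m \<le> \<phi>' a"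
    and A: "antimono_on {a..b} A" "A a \<le> 1" "\<And>t. t \<in> {a..b} \<Longrightarrow> 0 \<le> A t"
  shows "\<bar>integral {a..b} (\<lambda>t. A t * cos (\<phi> t))\<bar> \<le> 4 / m"
proof -
  \<comment> \<open>The sign makes \<open>g\<close> increasing, the form of monotonicity that the mean value theorem takes.\<close>
  define g where "g t = - (A t / \<phi>' t)" for t
  define f where "f t = \<phi>' t * cos (\<phi> t)" for t
  have \<phi>'_ge: "m \<le> \<phi>' t" if "t \<in> {a..b}" for t
    using monotone_onD[OF mono, of a t] that m(2) \<open>a \<le> b\<close> by auto
  have A_le: "A t \<le> 1" if "t \<in> {a..b}" for t
    using monotone_onD[OF A(1), of a t] that A(2) \<open>a \<le> b\<close> by auto
  have FTC: "(f has_integral sin (\<phi> v) - sin (\<phi> u)) {u..v}" if "a \<le> u" "u \<le> v" "v \<le> b" for u v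
  proof (rule fundamental_theorem_of_calculus[OF \<open>u \<le> v\<close>])
    fix t assume "t \<in> {u..v}"
    then have "((\<lambda>t. sin (\<phi> t)) has_real_derivative f t) (at t)"
      unfolding f_def using that by (auto intro!: derivative_eq_intros \<phi>)
    then show "((\<lambda>t. sin (\<phi> t)) has_vector_derivative f t) (at t within {u..v})"
      by (simp add: has_real_derivative_iff_has_vector_derivative has_vector_derivative_at_within)
  qed
  have g_mono: "g s \<le> g t" if "a \<le> s" "s \<le> t" "t \<le> b" for s t
  proof -
    have "A t / \<phi>' t \<le> A s / \<phi>' s"
      using monotone_onD[OF A(1), of s t] monotone_onD[OF mono, of s t] A(3)[of s] \<phi>'_ge[of s] m that
      by (intro frac_le) auto
    then show ?thesis by (simp add: g_def)
  qed
  have g_bound: "\<bar>g t\<bar> \<le> 1 / m" if "t \<in> {a..b}" for t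
    unfolding g_def using A(3)[OF that] A_le[OF that] \<phi>'_ge[OF that] m
    by (simp add: frac_le)
  obtain c where c: "c \<in> {a..b}"
    "integral {a..b} (\<lambda>t. g t * f t) = g a * integral {a..c} f + g b * integral {c..b} f"
    using second_mean_value_theorem[of f a b g] FTC[of a b] g_mono \<open>a \<le> b\<close>
    by (metis has_integral_integrable order_refl)
  have sin_diff: "\<bar>sin u - sin v\<bar> \<le> 2" for u v :: real
    using abs_sin_le_one[of u] abs_sin_le_one[of v] by linarith
  have "\<bar>integral {a..b} (\<lambda>t. g t * f t)\<bar> \<le>
      \<bar>g a\<bar> * \<bar>sin (\<phi> c) - sin (\<phi> a)\<bar> + \<bar>g b\<bar> * \<bar>sin (\<phi> b) - sin (\<phi> c)\<bar>"
    using c FTC[of a c, THEN integral_unique] FTC[of c b, THEN integral_unique]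
    by (simp flip: abs_mult)
  also have "\<dots> \<le> 1 / m * 2 + 1 / m * 2"
    using \<open>a \<le> b\<close> m by (intro add_mono mult_mono g_bound sin_diff) auto
  also have "integral {a..b} (\<lambda>t. g t * f t) = integral {a..b} (\<lambda>t. - (A t * cos (\<phi> t)))"
  proof (rule integral_cong)
    fix t assume "t \<in> {a..b}"
    then have "\<phi>' t \<noteq> 0" using \<phi>'_ge[of t] m(1) by auto
    then show "g t * f t = - (A t * cos (\<phi> t))" by (simp add: g_def f_def)
  qed
  finally show ?thesis by simp
qed

section \<open>The rescaled integrand\<close>

text \<open>
  For \<open>k\<^sup>3 = n\<close> this is the real part of \<open>gauss_wave\<close> in the rescaled variable, up to a constant
  factor. Its limit as \<open>k \<rightarrow> \<infinity>\<close> is the integrand of the Airy function at \<open>\<xi>\<close>.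
\<close>
definition airy_wave :: "real \<Rightarrow> real \<Rightarrow> real \<Rightarrow> real" where
  "airy_wave \<xi> k v = exp (k ^ 3 / 2 * (ln (1 + (v / k)\<^sup>2) - (v / k)\<^sup>2)) *
     cos (k ^ 3 * (v / k - arctan (v / k)) + \<xi> * v)"

lemma ln_minus_self_antimono:
  fixes s t :: real
  assumes "0 \<le> s" "s \<le> t"
  shows "ln (1 + t) - t \<le> ln (1 + s) - s"
proof -
  have "ln (1 + t) - ln (1 + s) = ln (1 + (t - s) / (1 + s))"
  proof -
    have "1 + (t - s) / (1 + s) = (1 + t) / (1 + s)" using assms by (simp add: field_simps)
    then show ?thesis using assms by (simp add: ln_div)
  qed
  also have "\<dots> \<le> (t - s) / (1 + s)"
    using assms by (intro ln_add_one_self_le_self) auto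
  also have "\<dots> \<le> t - s"
    using assms by (simp add: field_simps mult_left_mono mult_right_mono)
  finally show ?thesis by simp
qed

lemma airy_wave_le_1:
  assumes "k \<ge> 0"
  shows "\<bar>airy_wave \<xi> k v\<bar> \<le> 1"
proof -
  have "exp (k ^ 3 / 2 * (ln (1 + (v / k)\<^sup>2) - (v / k)\<^sup>2)) \<le> 1"
    using ln_minus_self_antimono[of 0 "(v / k)\<^sup>2"] assms
    by (auto intro!: mult_nonneg_nonpos simp del: ln_le_cancel_iff)
  then show ?thesis
    by (auto simp: airy_wave_def abs_mult intro!: mult_le_one)
qed

lemma continuous_airy_wave: "continuous_on S (airy_wave \<xi> k)"
proof -
  have "1 + (v / k)\<^sup>2 \<noteq> 0" for v by (metis add_pos_nonneg less_irrefl zero_le_power2 zero_less_one)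
  then show ?thesis unfolding airy_wave_def divide_inverse by (intro continuous_intros) auto
qed

text \<open>
  The derivative of the phase is \<open>v\<^sup>2 / (1 + (v / k)\<^sup>2) + \<xi>\<close>. It saturates near \<open>k\<^sup>2\<close> for large \<open>v\<close>,
  but as long as \<open>R \<le> k\<close> its value at \<open>R\<close> is still at least half of \<open>R\<^sup>2\<close>, plus \<open>\<xi>\<close>. The
  resulting bound is free of \<open>k\<close>, which is what the passage to the limit needs.
\<close>
lemma airy_wave_tail_bound:
  assumes "0 < k" "0 \<le> R" "R \<le> k" "0 < m" "m \<le> R\<^sup>2 / 2 + \<xi>" "R \<le> S"
  shows "\<bar>integral {R..S} (airy_wave \<xi> k)\<bar> \<le> 4 / m"
  unfolding airy_wave_def
proof (rule oscillatory_integral_bound[OF \<open>R \<le> S\<close> _ _ \<open>0 < m\<close>])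
  \<comment> \<open>This form of \<open>v\<^sup>2 / (1 + (v / k)\<^sup>2) + \<xi>\<close> shows the monotonicity.\<close>
  define \<phi>' where "\<phi>' v = k\<^sup>2 - k\<^sup>2 / (1 + (v / k)\<^sup>2) + \<xi>" for v
  have pos: "1 + (v / k)\<^sup>2 > 0" for v by (simp add: add_pos_nonneg)
  show "((\<lambda>v. k ^ 3 * (v / k - arctan (v / k)) + \<xi> * v) has_real_derivative \<phi>' v) (at v)" for v
  proof -
    have "k ^ 3 * (1 / k - inverse q / k) = k\<^sup>2 - k\<^sup>2 / q" if "q > 0" for q
      using \<open>0 < k\<close> that by (simp add: field_simps power2_eq_square power3_eq_cube)
    then have "\<phi>' v = k ^ 3 * (1 / k - inverse (1 + (v / k)\<^sup>2) / k) + \<xi>"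
      using pos[of v] by (simp add: \<phi>'_def)
    then show ?thesis
      using \<open>0 < k\<close> by (auto intro!: derivative_eq_intros simp: divide_inverse mult_ac)
  qed
  show "mono_on {R..S} \<phi>'"
    unfolding \<phi>'_def using \<open>0 \<le> R\<close> \<open>0 < k\<close> pos
    by (intro mono_onI add_right_mono diff_left_mono divide_left_mono add_left_mono power_mono
          divide_right_mono mult_pos_pos) auto
  have "R\<^sup>2 \<le> k\<^sup>2" using assms by (intro power_mono) auto
  have "\<phi>' R = R\<^sup>2 / (1 + (R / k)\<^sup>2) + \<xi>"
    unfolding \<phi>'_def using \<open>0 < k\<close> pos[of R] by (simp add: field_simps)
  moreover have "R\<^sup>2 / 2 \<le> R\<^sup>2 / (1 + (R / k)\<^sup>2)"
    using \<open>R\<^sup>2 \<le> k\<^sup>2\<close> \<open>0 < k\<close> pos[of R]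
    by (intro divide_left_mono) (auto simp: power_divide)
  ultimately show "m \<le> \<phi>' R" using assms by linarith
  show "antimono_on {R..S} (\<lambda>v. exp (k ^ 3 / 2 * (ln (1 + (v / k)\<^sup>2) - (v / k)\<^sup>2)))"
  proof (rule monotone_onI)
    fix u v assume "u \<in> {R..S}" "v \<in> {R..S}" "u \<le> v"
    then show "exp (k ^ 3 / 2 * (ln (1 + (v / k)\<^sup>2) - (v / k)\<^sup>2))
        \<le> exp (k ^ 3 / 2 * (ln (1 + (u / k)\<^sup>2) - (u / k)\<^sup>2))"
      using assms unfolding exp_le_cancel_iff
      by (intro mult_left_mono ln_minus_self_antimono power_mono divide_right_mono) auto
  qed
  show "exp (k ^ 3 / 2 * (ln (1 + (R / k)\<^sup>2) - (R / k)\<^sup>2)) \<le> 1"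
    using ln_minus_self_antimono[of 0 "(R / k)\<^sup>2"] assms
    by (auto intro!: mult_nonneg_nonpos)
qed auto

lemma airy_wave_tendsto:
  "((\<lambda>k. airy_wave \<xi> k v) \<longlongrightarrow> cos (v ^ 3 / 3 + \<xi> * v)) at_top"
proof (cases v "0::real" rule: linorder_cases)
  case less
  then have 1: "((\<lambda>k. k ^ 3 / 2 * (ln (1 + (v / k)\<^sup>2) - (v / k)\<^sup>2)) \<longlongrightarrow> 0) at_top"
    and 2: "((\<lambda>k. k ^ 3 * (v / k - arctan (v / k))) \<longlongrightarrow> v ^ 3 / 3) at_top"
    by (real_asymp, real_asymp, simp add: power3_eq_cube)
  show ?thesis unfolding airy_wave_def by (rule tendsto_eq_intros 1 2 refl | simp)+
next
  case equal
  then show ?thesis by (simp add: airy_wave_def)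
next
  case greater
  then have 1: "((\<lambda>k. k ^ 3 / 2 * (ln (1 + (v / k)\<^sup>2) - (v / k)\<^sup>2)) \<longlongrightarrow> 0) at_top"
    and 2: "((\<lambda>k. k ^ 3 * (v / k - arctan (v / k))) \<longlongrightarrow> v ^ 3 / 3) at_top"
    by (real_asymp, real_asymp, simp add: power3_eq_cube)
  show ?thesis unfolding airy_wave_def by (rule tendsto_eq_intros 1 2 refl | simp)+
qed

section \<open>Convergence to the Airy integral\<close>

text \<open>
  A Moore-Osgood theorem for improper integrals: tails that are small uniformly in \<open>n\<close> pass to the
  limit \<open>G\<close>, so \<open>G\<close> has a limit too. In the application this
  limit is the Airy integral, whose convergence is thus obtained at the same time.
\<close>
lemma improper_limit_interchange:
  fixes F :: "nat \<Rightarrow> real \<Rightarrow> real"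
  assumes pointwise: "\<And>R. R \<ge> 0 \<Longrightarrow> (\<lambda>n. F n R) \<longlonglongrightarrow> G R"
    and improper: "\<forall>\<^sub>F n in sequentially. (F n \<longlongrightarrow> L n) at_top"
    and tail: "\<And>e. e > 0 \<Longrightarrow> \<exists>R\<ge>0. \<forall>\<^sub>F n in sequentially. \<forall>S\<ge>R. \<bar>F n S - F n R\<bar> \<le> e"
  obtains l where "(G \<longlongrightarrow> l) at_top" "L \<longlonglongrightarrow> l"
proof -
  have G_tail: "\<bar>G S - G R\<bar> \<le> e"
    if "R \<ge> 0" "\<forall>\<^sub>F n in sequentially. \<forall>S\<ge>R. \<bar>F n S - F n R\<bar> \<le> e" "S \<ge> R" for R S e
  proof (rule tendsto_upperbound)
    show "(\<lambda>n. \<bar>F n S - F n R\<bar>) \<longlonglongrightarrow> \<bar>G S - G R\<bar>"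
      using that by (intro tendsto_intros pointwise) auto
    show "\<forall>\<^sub>F n in sequentially. \<bar>F n S - F n R\<bar> \<le> e"
      using that(2) by eventually_elim (use that in auto)
  qed simp
  have "Cauchy (\<lambda>n. G (real n))"
  proof (rule metric_CauchyI)
    fix e :: real assume "e > 0"
    obtain R where R: "R \<ge> 0" "\<forall>\<^sub>F n in sequentially. \<forall>S\<ge>R. \<bar>F n S - F n R\<bar> \<le> e / 3"
      using tail[of "e / 3"] \<open>e > 0\<close> by auto
    have "dist (G (real m)) (G (real n)) < e" if "m \<ge> nat \<lceil>R\<rceil>" "n \<ge> nat \<lceil>R\<rceil>" for m n
    proof -
      have "real m \<ge> R" "real n \<ge> R" using that by linarith+
      then show ?thesis
        using G_tail[OF R, of "real m"] G_tail[OF R, of "real n"] \<open>e > 0\<close>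
        unfolding dist_real_def by linarith
    qed
    then show "\<exists>M. \<forall>m\<ge>M. \<forall>n\<ge>M. dist (G (real m)) (G (real n)) < e" by blast
  qed
  then obtain l where l: "(\<lambda>n. G (real n)) \<longlonglongrightarrow> l"
    using Cauchy_convergent_iff convergent_def by blast
  \<comment> \<open>So far \<open>l\<close> is a limit along the integers; the tail bound extends it to all real arguments.\<close>
  have close: "\<bar>l - G R\<bar> \<le> e"
    if "R \<ge> 0" "\<forall>\<^sub>F n in sequentially. \<forall>S\<ge>R. \<bar>F n S - F n R\<bar> \<le> e" for R e
  proof (rule tendsto_upperbound)
    show "(\<lambda>n. \<bar>G (real n) - G R\<bar>) \<longlonglongrightarrow> \<bar>l - G R\<bar>" by (intro tendsto_intros l)
    have "\<forall>\<^sub>F n in sequentially. real n \<ge> R"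
      using filterlim_real_sequentially by (simp add: filterlim_at_top)
    then show "\<forall>\<^sub>F n in sequentially. \<bar>G (real n) - G R\<bar> \<le> e"
      by eventually_elim (use G_tail that in auto)
  qed simp
  have "(G \<longlongrightarrow> l) at_top"
  proof (rule tendstoI)
    fix e :: real assume "e > 0"
    obtain R where R: "R \<ge> 0" "\<forall>\<^sub>F n in sequentially. \<forall>S\<ge>R. \<bar>F n S - F n R\<bar> \<le> e / 3"
      using tail[of "e / 3"] \<open>e > 0\<close> by auto
    show "\<forall>\<^sub>F S in at_top. dist (G S) l < e"
      using eventually_ge_at_top[of R]
    proof eventually_elim
      case (elim S)
      then show ?case
        using G_tail[OF R elim] close[OF R] \<open>e > 0\<close> unfolding dist_real_def by linarith
    qed
  qed
  moreover have "L \<longlonglongrightarrow> l"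
  proof (rule tendstoI)
    fix e :: real assume "e > 0"
    obtain R where R: "R \<ge> 0" "\<forall>\<^sub>F n in sequentially. \<forall>S\<ge>R. \<bar>F n S - F n R\<bar> \<le> e / 4"
      using tail[of "e / 4"] \<open>e > 0\<close> by auto
    have "\<forall>\<^sub>F n in sequentially. dist (F n R) (G R) < e / 4"
      using tendstoD[OF pointwise[OF R(1)], of "e / 4"] \<open>e > 0\<close> by simp
    with R(2) improper show "\<forall>\<^sub>F n in sequentially. dist (L n) l < e"
    proof eventually_elim
      case (elim n)
      have "\<bar>L n - F n R\<bar> \<le> e / 4"
      proof (rule tendsto_upperbound)
        show "((\<lambda>S. \<bar>F n S - F n R\<bar>) \<longlongrightarrow> \<bar>L n - F n R\<bar>) at_top"
          by (intro tendsto_intros elim)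
        show "\<forall>\<^sub>F S in at_top. \<bar>F n S - F n R\<bar> \<le> e / 4"
          using eventually_ge_at_top[of R] by eventually_elim (use elim in auto)
      qed simp
      then show ?case
        using elim(3) close[OF R] \<open>e > 0\<close> unfolding dist_real_def by linarith
    qed
  qed
  ultimately show ?thesis by (rule that)
qed

lemma airy_wave_integrals_tendsto:
  assumes "filterlim k at_top sequentially" "\<And>n. k n \<ge> 0"
    and int: "\<forall>\<^sub>F n in sequentially. integrable lborel (airy_wave \<xi> (k n))"
  shows "(\<lambda>n. LBINT v:{0..}. airy_wave \<xi> (k n) v) \<longlonglongrightarrow> pi * Airy_Ai \<xi>"
proof -
  let ?F = "\<lambda>n R. integral {0..R} (airy_wave \<xi> (k n))"
  let ?G = "\<lambda>R. integral {0..R} (\<lambda>t. cos (t ^ 3 / 3 + \<xi> * t))"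
  have pointwise: "(\<lambda>n. ?F n R) \<longlonglongrightarrow> ?G R" for R
  proof (rule dominated_convergence(2)[where h = "\<lambda>_. 1"])
    show "airy_wave \<xi> (k n) integrable_on {0..R}" for n
      by (intro integrable_continuous_interval continuous_airy_wave)
    show "(\<lambda>n. airy_wave \<xi> (k n) v) \<longlonglongrightarrow> cos (v ^ 3 / 3 + \<xi> * v)" for v
      by (rule filterlim_compose[OF airy_wave_tendsto assms(1)])
  qed (use airy_wave_le_1 assms(2) in auto)
  have tail: "\<exists>R\<ge>0. \<forall>\<^sub>F n in sequentially. \<forall>S\<ge>R. \<bar>?F n S - ?F n R\<bar> \<le> e" if "e > 0" for e
  proof -
    \<comment> \<open>A phase derivative of at least \<open>4 / e\<close> is wanted, and \<open>R \<ge> 1\<close> gives \<open>R \<le> R\<^sup>2\<close>.\<close>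
    define m where "m = 4 / e"
    define R where "R = 1 + 2 * (m + \<bar>\<xi>\<bar>)"
    have "m > 0" using that by (simp add: m_def)
    then have "R \<ge> 1" by (simp add: R_def)
    then have "R \<le> R\<^sup>2" by (simp add: power2_eq_square)
    then have "m \<le> R\<^sup>2 / 2 + \<xi>" by (simp add: R_def)
    have "\<forall>\<^sub>F n in sequentially. k n \<ge> R" using assms(1) by (simp add: filterlim_at_top)
    then have "\<forall>\<^sub>F n in sequentially. \<forall>S\<ge>R. \<bar>?F n S - ?F n R\<bar> \<le> e"
    proof eventually_elim
      case (elim n)
      show ?case
      proof safe
        fix S assume "S \<ge> R"
        have "?F n R + integral {R..S} (airy_wave \<xi> (k n)) = ?F n S"
          using \<open>R \<ge> 1\<close> \<open>S \<ge> R\<close>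
          by (intro Henstock_Kurzweil_Integration.integral_combine integrable_continuous_interval
                continuous_airy_wave) auto
        moreover have "\<bar>integral {R..S} (airy_wave \<xi> (k n))\<bar> \<le> 4 / m"
          using elim \<open>R \<ge> 1\<close> \<open>S \<ge> R\<close> \<open>m > 0\<close> \<open>m \<le> R\<^sup>2 / 2 + \<xi>\<close>
          by (intro airy_wave_tail_bound) auto
        ultimately show "\<bar>?F n S - ?F n R\<bar> \<le> e" using that by (simp add: m_def)
      qed
    qed
    then show ?thesis using \<open>R \<ge> 1\<close> by (intro exI[of _ R]) auto
  qed
  have improper: "\<forall>\<^sub>F n in sequentially. (?F n \<longlongrightarrow> (LBINT v:{0..}. airy_wave \<xi> (k n) v)) at_top"
    using int
  proof eventually_elim
    case (elim n)
    have si: "set_integrable lborel A (airy_wave \<xi> (k n))" if "A \<in> sets borel" for A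
      using elim that unfolding set_integrable_def by (intro integrable_mult_indicator) auto
    have "((\<lambda>R. LBINT v:{0..R}. airy_wave \<xi> (k n) v) \<longlongrightarrow> (LBINT v:{0..}. airy_wave \<xi> (k n) v)) at_top"
      by (rule tendsto_set_lebesgue_integral_at_top) (auto intro: si)
    then show ?case by (simp add: set_borel_integral_eq_integral(2)[OF si])
  qed
  obtain l where "(?G \<longlongrightarrow> l) at_top" "(\<lambda>n. LBINT v:{0..}. airy_wave \<xi> (k n) v) \<longlonglongrightarrow> l"
    using improper_limit_interchange[where F = ?F and G = ?G, OF pointwise improper tail] by blast
  then show ?thesis by (simp add: Airy_Ai_def tendsto_Lim)
qed

lemma airy_wave_even: "airy_wave \<xi> k (- v) = airy_wave \<xi> k v"
proof -
  have "k ^ 3 * (- v / k - arctan (- v / k)) + \<xi> * - v =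
      - (k ^ 3 * (v / k - arctan (v / k)) + \<xi> * v)"
    by (simp add: arctan_minus algebra_simps)
  then show ?thesis unfolding airy_wave_def by (simp only: cos_minus) simp
qed

section \<open>The turning point\<close>

text \<open>
  The value \<open>c = sqrt (n / 2)\<close> makes \<open>2 c + i sqrt 2 t\<close> equal to \<open>sqrt (2 n) * (1 + i u)\<close>, and the
  terms of the phase that are linear in \<open>u\<close> combine to \<open>- n u - \<xi> v\<close>. So the linear part of
  \<open>n * arctan u\<close> cancels and a cubic phase remains.
\<close>
lemma Re_gauss_wave_eq_airy_wave:
  fixes \<beta> :: real
  assumes "n \<ge> 1"
  defines "k \<equiv> real n powr (1 / 3)"
  defines "c \<equiv> sqrt (real n / 2)" and "x \<equiv> sqrt (2 * real n) + \<beta> * real n powr (- 1 / 6)"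
  shows "Re (gauss_wave c (sqrt 2 * (c - x)) n (sqrt k * v)) =
     sqrt (2 * real n) ^ n / sqrt (2 * pi) * airy_wave (sqrt 2 * \<beta>) k v"
proof -
  define u where "u = v / k"
  have k: "k > 0" using assms by simp
  have k3: "k ^ 3 = real n"
    using assms by (simp add: k_def powr_powr flip: powr_numeral)
  have sqrt_k: "sqrt k = real n powr (1 / 6)"
    by (simp add: k_def powr_powr flip: powr_half_sqrt)
  have sqrt_n: "sqrt (real n) = k * sqrt k"
    using k by (simp add: real_sqrt_mult power3_eq_cube flip: k3)
  have n_k: "real n powr (- 1 / 6) * sqrt k = 1"
    using assms(1) by (simp add: sqrt_k flip: powr_add)
  have c2: "2 * c = sqrt (2 * real n)"
    by (simp add: c_def real_sqrt_mult real_sqrt_divide field_simps)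
  have dens: "std_normal_density (sqrt k * v) = exp (- (k ^ 3 / 2 * u\<^sup>2)) / sqrt (2 * pi)"
    using k by (simp add: std_normal_density_def u_def field_simps power2_eq_square power3_eq_cube)
  have polar: "1 + \<i> * complex_of_real u = sqrt (1 + u\<^sup>2) *\<^sub>R cis (arctan u)"
    by (simp add: complex_eq_iff cos_arctan sin_arctan add_nonneg_eq_0_iff)
  have "2 * complex_of_real c + \<i> * (sqrt 2 * (sqrt k * v)) =
      sqrt (2 * real n) *\<^sub>R (1 + \<i> * complex_of_real u)"
    using c2 k by (simp add: complex_eq_iff u_def sqrt_n real_sqrt_mult)
  then have base: "2 * complex_of_real c + \<i> * (sqrt 2 * (sqrt k * v)) =
      (sqrt (2 * real n) * sqrt (1 + u\<^sup>2)) *\<^sub>R cis (arctan u)"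
    by (simp add: polar)
  have sqrt_exp: "sqrt (1 + u\<^sup>2) ^ n = exp (k ^ 3 / 2 * ln (1 + u\<^sup>2))"
  proof -
    have "1 + u\<^sup>2 > 0" by (simp add: add_pos_nonneg)
    then have "sqrt (1 + u\<^sup>2) ^ n = ((1 + u\<^sup>2) powr (1 / 2)) powr real n"
      by (simp add: powr_realpow powr_half_sqrt)
    then show ?thesis
      using \<open>1 + u\<^sup>2 > 0\<close> by (simp add: powr_powr k3) (simp add: powr_def)
  qed
  have phase: "sqrt 2 * (c - x) * (sqrt k * v) = - (k ^ 3 * u) - sqrt 2 * \<beta> * v"
  proof -
    have "sqrt 2 * (c - x) * sqrt k = - (sqrt (real n) * sqrt k) - sqrt 2 * \<beta> * (real n powr (- 1 / 6) * sqrt k)"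
      by (simp add: c_def x_def real_sqrt_mult real_sqrt_divide algebra_simps)
    also have "\<dots> = - (k * k) - sqrt 2 * \<beta>"
      using k unfolding sqrt_n n_k by (simp add: mult.assoc)
    finally have "(sqrt 2 * (c - x) * sqrt k) * v = (- (k * k) - sqrt 2 * \<beta>) * v" by simp
    then show ?thesis
      using k by (simp add: u_def power3_eq_cube algebra_simps)
  qed
  have "gauss_wave c (sqrt 2 * (c - x)) n (sqrt k * v) =
      (exp (- (k ^ 3 / 2 * u\<^sup>2)) / sqrt (2 * pi) * (sqrt (2 * real n) ^ n * exp (k ^ 3 / 2 * ln (1 + u\<^sup>2))))
        *\<^sub>R cis (real n * arctan u + (- (k ^ 3 * u) - sqrt 2 * \<beta> * v))"
    unfolding gauss_wave_def base phase dens scaleR_power Complex.DeMoivre power_mult_distrib sqrt_exp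
    by (simp add: cis_mult)
  also have "Re \<dots> = sqrt (2 * real n) ^ n / sqrt (2 * pi) *
      (exp (k ^ 3 / 2 * (ln (1 + u\<^sup>2) - u\<^sup>2)) * cos (- (k ^ 3 * (u - arctan u) + sqrt 2 * \<beta> * v)))"
    by (simp add: k3 algebra_simps flip: exp_add)
  finally show ?thesis by (simp add: airy_wave_def u_def del: minus_add_distrib)
qed

lemma hermite_airy_wave:
  fixes \<beta> :: real
  assumes "n \<ge> 1"
  defines "k \<equiv> real n powr (1 / 3)"
  defines "x \<equiv> sqrt (2 * real n) + \<beta> * real n powr (- 1 / 6)"
  shows "integrable lborel (airy_wave (sqrt 2 * \<beta>) k)"
    and "hermite n x = exp ((x - sqrt (real n / 2))\<^sup>2) * sqrt (2 * real n) ^ n / sqrt (2 * pi) * sqrt k *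
      (2 * (LBINT v:{0..}. airy_wave (sqrt 2 * \<beta>) k v))"
proof -
  define c where "c = sqrt (real n / 2)"
  define b where "b = sqrt 2 * (c - x)"
  define M where "M = sqrt (2 * real n) ^ n / sqrt (2 * pi)"
  have M: "M \<noteq> 0" using assms(1) by (simp add: M_def)
  have k: "sqrt k > 0" using assms(1) by (simp add: k_def)
  have Re_eq: "Re (gauss_wave c b n (0 + sqrt k * v)) = M * airy_wave (sqrt 2 * \<beta>) k v" for v
    using Re_gauss_wave_eq_airy_wave[OF assms(1), of \<beta> v]
    by (simp add: c_def b_def M_def k_def x_def)
  have "integrable lborel (\<lambda>t. Re (gauss_wave c b n t))"
    by (intro integrable_Re integrable_gauss_wave)
  then have "integrable lborel (\<lambda>v. M * airy_wave (sqrt 2 * \<beta>) k v)"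
    using lborel_integrable_real_affine_iff[of "sqrt k" "\<lambda>t. Re (gauss_wave c b n t)" 0] k
    by (simp only: Re_eq)
  then show int: "integrable lborel (airy_wave (sqrt 2 * \<beta>) k)" using M by simp
  have "has_bochner_integral lborel (airy_wave (sqrt 2 * \<beta>) k)
      (2 *\<^sub>R (LBINT v:{0..}. airy_wave (sqrt 2 * \<beta>) k v))"
    unfolding set_lebesgue_integral_def
    by (intro has_bochner_integral_even_function has_bochner_integral_integrable
          integrable_mult_indicator int airy_wave_even) auto
  then have half: "integral\<^sup>L lborel (airy_wave (sqrt 2 * \<beta>) k) =
      2 * (LBINT v:{0..}. airy_wave (sqrt 2 * \<beta>) k v)"
    by (simp add: has_bochner_integral_integral_eq)
  have "hermite n x = Re (exp ((x - c)\<^sup>2) * integral\<^sup>L lborel (gauss_wave c b n))"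
    unfolding b_def by (simp flip: hermite_eq_integral_gauss_wave)
  also have "\<dots> = exp ((x - c)\<^sup>2) * (LBINT t. Re (gauss_wave c b n t))"
    by (simp add: integrable_gauss_wave)
  also have "(LBINT t. Re (gauss_wave c b n t)) = sqrt k * (LBINT v. Re (gauss_wave c b n (0 + sqrt k * v)))"
    using k by (subst lborel_integral_real_affine[of "sqrt k" _ 0]) auto
  also have "\<dots> = sqrt k * (M * (2 * (LBINT v:{0..}. airy_wave (sqrt 2 * \<beta>) k v)))"
    by (simp add: Re_eq half del: add_0)
  finally show "hermite n x = exp ((x - sqrt (real n / 2))\<^sup>2) * sqrt (2 * real n) ^ n / sqrt (2 * pi) * sqrt k *
      (2 * (LBINT v:{0..}. airy_wave (sqrt 2 * \<beta>) k v))"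
    by (simp add: M_def c_def)
qed

text \<open>
  Since \<open>(x - c)\<^sup>2 = n / 2 + sqrt (2 n) * \<beta> * n powr (-1/6) + \<beta>\<^sup>2 / k\<close>, the prefactor of the integral
  representation differs from that of the asymptotic formula, apart from constants, only by
  \<open>exp (\<beta>\<^sup>2 / k)\<close>, which tends to 1.
\<close>
lemma hermite_prefactor:
  fixes \<beta> :: real
  assumes "n \<ge> 1"
  defines "k \<equiv> real n powr (1 / 3)"
  defines "x \<equiv> sqrt (2 * real n) + \<beta> * real n powr (- 1 / 6)"
  shows "exp ((x - sqrt (real n / 2))\<^sup>2) * sqrt (2 * real n) ^ n / sqrt (2 * pi) * sqrt k * (2 * J) =
    exp (real n / 2 * ln (2 * real n) - 3 / 2 * real n + sqrt (2 * real n) * x)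
      * sqrt (2 * pi) * real n powr (1 / 6) * (exp (\<beta>\<^sup>2 / k) * (J / pi))"
proof -
  have sqrt_k: "sqrt k = real n powr (1 / 6)"
    by (simp add: k_def powr_powr flip: powr_half_sqrt)
  have n_k: "(real n powr (- 1 / 6))\<^sup>2 = 1 / k"
    using assms(1) by (simp add: k_def powr_minus_divide power2_eq_square flip: powr_add)
  have "sqrt (2 * real n) ^ n = ((2 * real n) powr (1 / 2)) powr real n"
    using assms(1) by (simp add: powr_realpow powr_half_sqrt)
  then have pow: "sqrt (2 * real n) ^ n = exp (real n / 2 * ln (2 * real n))"
    using assms(1) by (simp add: powr_powr) (simp add: powr_def)
  have "sqrt (real n / 2) = sqrt (2 * real n) / 2"
    by (simp add: real_sqrt_mult real_sqrt_divide field_simps)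
  then have "x - sqrt (real n / 2) = sqrt (2 * real n) / 2 + \<beta> * real n powr (- 1 / 6)"
    by (simp add: x_def)
  then have "(x - sqrt (real n / 2))\<^sup>2 = (sqrt (2 * real n))\<^sup>2 / 4
      + sqrt (2 * real n) * (\<beta> * real n powr (- 1 / 6)) + \<beta>\<^sup>2 * (real n powr (- 1 / 6))\<^sup>2"
    by (simp add: power2_eq_square algebra_simps)
  also have "\<dots> = - 3 / 2 * real n + sqrt (2 * real n) * x + \<beta>\<^sup>2 / k"
    unfolding n_k by (simp add: x_def algebra_simps)
  finally have "exp ((x - sqrt (real n / 2))\<^sup>2) * sqrt (2 * real n) ^ n =
      exp (real n / 2 * ln (2 * real n) - 3 / 2 * real n + sqrt (2 * real n) * x) * exp (\<beta>\<^sup>2 / k)"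
    by (simp add: pow flip: exp_add)
  moreover have "2 / sqrt (2 * pi) = sqrt (2 * pi) / pi"
    by (simp add: field_simps)
  ultimately show ?thesis
    by (simp add: sqrt_k field_simps)
qed

theorem theorem3:
  fixes \<beta> :: real and x :: "nat \<Rightarrow> real"
  assumes x: "\<And>n. n \<ge> 1 \<Longrightarrow> x n = sqrt (2 * real n) + \<beta> * real n powr (- 1 / 6)"
  shows "\<exists>\<epsilon> :: nat \<Rightarrow> real. \<epsilon> \<in> o(\<lambda>_. 1) \<and>
    (\<forall>n\<ge>1. hermite n (x n) =
      exp (real n / 2 * ln (2 * real n) - 3 / 2 * real n + sqrt (2 * real n) * x n)
      * sqrt (2 * pi) * real n powr (1 / 6)
      * (Airy_Ai (sqrt 2 * (x n - sqrt (2 * real n)) * real n powr (1 / 6)) + \<epsilon> n))"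
proof -
  define \<xi> where "\<xi> = sqrt 2 * \<beta>"
  define k where "k n = real n powr (1 / 3)" for n
  define J where "J n = (LBINT v:{0..}. airy_wave \<xi> (k n) v)" for n
  define \<epsilon> where "\<epsilon> n = exp (\<beta>\<^sup>2 / k n) * (J n / pi) - Airy_Ai \<xi>" for n
  have k: "filterlim k at_top sequentially" unfolding k_def by real_asymp
  have "J \<longlonglongrightarrow> pi * Airy_Ai \<xi>"
    unfolding J_def
  proof (rule airy_wave_integrals_tendsto[OF k])
    show "\<forall>\<^sub>F n in sequentially. integrable lborel (airy_wave \<xi> (k n))"
      using eventually_ge_at_top[of 1]
      by eventually_elim (simp add: k_def \<xi>_def hermite_airy_wave(1))
  qed (simp add: k_def)
  moreover have "(\<lambda>n. exp (\<beta>\<^sup>2 / k n)) \<longlonglongrightarrow> exp 0"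
    by (intro tendsto_exp real_tendsto_divide_at_top[OF tendsto_const k])
  ultimately have "(\<lambda>n. exp (\<beta>\<^sup>2 / k n) * (J n / pi) - Airy_Ai \<xi>) \<longlonglongrightarrow>
      exp 0 * (pi * Airy_Ai \<xi> / pi) - Airy_Ai \<xi>"
    by (intro tendsto_diff tendsto_mult tendsto_divide tendsto_const) auto
  then have "\<epsilon> \<longlonglongrightarrow> 0" by (simp add: \<epsilon>_def[abs_def])
  then have "\<epsilon> \<in> o(\<lambda>_. 1)" by (intro smalloI_tendsto) auto
  moreover have "hermite n (x n) =
      exp (real n / 2 * ln (2 * real n) - 3 / 2 * real n + sqrt (2 * real n) * x n)
      * sqrt (2 * pi) * real n powr (1 / 6)
      * (Airy_Ai (sqrt 2 * (x n - sqrt (2 * real n)) * real n powr (1 / 6)) + \<epsilon> n)" if "n \<ge> 1" for n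
  proof -
    have "sqrt 2 * (x n - sqrt (2 * real n)) * real n powr (1 / 6) = \<xi>"
      using that by (simp add: x \<xi>_def flip: powr_add)
    then have "Airy_Ai (sqrt 2 * (x n - sqrt (2 * real n)) * real n powr (1 / 6)) + \<epsilon> n =
        exp (\<beta>\<^sup>2 / k n) * (J n / pi)"
      by (simp add: \<epsilon>_def)
    then show ?thesis
      using hermite_airy_wave(2)[OF that, of \<beta>] hermite_prefactor[OF that, of \<beta> "J n"]
      by (simp only: x[OF that] J_def k_def \<xi>_def)
  qed
  ultimately show ?thesis by blast
qed

end
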